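(* Let $p\in(1,+\infty)$ and let $(\varphi_n)$ be a bounded sequence in $L^p(\mathbb{R}_+)$ of non-negative functions such that $$\exists\,\mu>0,\qquad\limsup_{n\to+\infty}\;x_\mu(\varphi_n)\;<\;+\infty.$$ Then the sequence $(\varphi_n^\natural)$ of tampings is weakly compact in $L^p(\mathbb{R}_+)$, i.e. it admits a subsequence converging weakly in $L^p(\mathbb{R}_+)$.
   Context: $\mathbb{R}_+=[0,+\infty)$, $\mathrm{meas}$ is Lebesgue measure, $A\triangle B=(A\cup B)\setminus(A\cap B)$, $\mathfrak{M}_+(\mathbb{R}_+)$ is the set of non-negative measurable functions on $\mathbb{R}_+$ (identified when equal a.e.), and $\{\varphi\ge\nu\}=\{x\in\mathbb{R}_+:\varphi(x)\ge\nu\}$. Hollows. For $A\subseteq\mathbb{R}_+$ measurable, the essential convex hull is $\mathrm{conv\,ess}\,A:=\bigcap_{\mathrm{meas}(A\triangle B)=0}\mathrm{conv}\,B$. The hollows of $A$ are $\mathcal{H}(A):=(\mathrm{conv\,ess}\,A)\setminus A$ (understood up to null sets). For $\varphi\in\mathfrak{M}_+(\mathbb{R}_+)$ and $\nu\in(0,+\infty]$, $\mathcal{H}_\nu(\varphi):=\bigcup_{\lambda<\nu}\mathcal{H}(\{\varphi\ge\lambda\})$. Tamping. For $\nu>0$ let $x_\nu(\varphi):=\mathrm{inf\,ess}\{\varphi\ge\nu\}\in[0,+\infty]$, where $\mathrm{inf\,ess}\,A:=\sup\{a\ge0:\mathrm{meas}(A\cap[0,a])=0\}$ (so $x_\nu(\varphi)=+\infty$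 if $\{\varphi\ge\nu\}$ is null), and, when $\mathrm{meas}\{\varphi\ge\nu\}>0$, $y_\nu(\varphi):=x_\nu(\varphi)-\mathrm{meas}(\mathcal{H}_\infty(\varphi)\cap[0,x_\nu(\varphi)])$. Put $S_\nu(\varphi):=[\,y_\nu(\varphi),\,y_\nu(\varphi)+\mathrm{meas}\{\varphi\ge\nu\}\,]$ (meaning $\emptyset$ if $\mathrm{meas}\{\varphi\ge\nu\}=0$, and $[y_\nu(\varphi),+\infty)$ if it is $+\infty$). These sets are non-increasing in $\nu$. The tamping $\varphi^\natural$ of $\varphi$ is the function whose superlevel sets $\{\varphi^\natural\ge\nu\}$ are the $S_\nu(\varphi)$; explicitly $\varphi^\natural(x):=\sup\{\nu>0: x\in S_\nu(\varphi)\}$ with $\sup\emptyset=0$ (for almost every $\nu$, $\{\varphi^\natural\ge\nu\}=S_\nu(\varphi)$ up to a null set). *)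

theory Defs
  imports "HOL-Analysis.Analysis"
begin

text \<open>
  A function on the half-line is a total function \<open>real \<Rightarrow> real\<close> of which only the values on
  \<open>{0..}\<close> are used; functions equal almost everywhere are identified.
\<close>

abbreviation half_line :: "real measure" where
  "half_line \<equiv> lebesgue_on {0..}"


subsection \<open>Lebesgue spaces and weak convergence\<close>

definition Lp :: "real \<Rightarrow> 'a measure \<Rightarrow> ('a \<Rightarrow> real) set" where
  "Lp p M = {f \<in> borel_measurable M. integrable M (\<lambda>x. \<bar>f x\<bar> powr p)}"

definition Lp_norm :: "real \<Rightarrow> 'a measure \<Rightarrow> ('a \<Rightarrow> real) \<Rightarrow> real" where
  "Lp_norm p M f = (\<integral>x. \<bar>f x\<bar> powr p \<partial>M) powr (1 / p)"

text \<open>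
  Continuous linear functionals on \<open>L\<^sup>p\<close>. The norm bound together with additivity makes \<open>T\<close> respect
  equality almost everywhere, so that \<open>T\<close> is a functional on the space of classes.
\<close>

definition Lp_dual :: "real \<Rightarrow> 'a measure \<Rightarrow> (('a \<Rightarrow> real) \<Rightarrow> real) set" where
  "Lp_dual p M = {T.
     (\<forall>f\<in>Lp p M. \<forall>g\<in>Lp p M. T (\<lambda>x. f x + g x) = T f + T g) \<and>
     (\<forall>c. \<forall>f\<in>Lp p M. T (\<lambda>x. c * f x) = c * T f) \<and>
     (\<exists>C. \<forall>f\<in>Lp p M. \<bar>T f\<bar> \<le> C * Lp_norm p M f)}"

definition weakly_converges_Lp ::
    "real \<Rightarrow> 'a measure \<Rightarrow> (nat \<Rightarrow> 'a \<Rightarrow> real) \<Rightarrow> ('a \<Rightarrow> real) \<Rightarrow> bool" where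
  "weakly_converges_Lp p M f g \<longleftrightarrow>
     (\<forall>n. f n \<in> Lp p M) \<and> g \<in> Lp p M \<and> (\<forall>T\<in>Lp_dual p M. (\<lambda>n. T (f n)) \<longlonglongrightarrow> T g)"


subsection \<open>Hollows\<close>

definition superlevel :: "(real \<Rightarrow> real) \<Rightarrow> real \<Rightarrow> real set" where
  "superlevel \<phi> \<nu> = {x \<in> {0..}. \<phi> x \<ge> \<nu>}"

definition conv_ess :: "real set \<Rightarrow> real set" where
  "conv_ess A = \<Inter> {convex hull B | B. B \<subseteq> {0..} \<and> sym_diff A B \<in> null_sets lebesgue}"

definition hollows :: "real set \<Rightarrow> real set" where
  "hollows A = conv_ess A - A"

text \<open>
  The union is uncountable, but \<open>conv_ess (superlevel \<phi> l)\<close> is an open interval (possibly empty) that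
  decreases in \<open>l\<close>; hence the union is Lebesgue measurable for measurable \<open>\<phi>\<close>, and changing \<open>\<phi>\<close> on
  a null set changes it by a null set only. Levels \<open>l \<le> 0\<close> contribute a null set when \<open>\<phi> \<ge> 0\<close>
  almost everywhere.
\<close>

definition hollows_below :: "ereal \<Rightarrow> (real \<Rightarrow> real) \<Rightarrow> real set" where
  "hollows_below \<nu> \<phi> = (\<Union>l\<in>{l. ereal l < \<nu>}. hollows (superlevel \<phi> l))"


subsection \<open>Tamping\<close>

definition inf_ess :: "real set \<Rightarrow> ereal" where
  "inf_ess A = Sup {ereal a | a. 0 \<le> a \<and> emeasure lebesgue (A \<inter> {0..a}) = 0}"

definition x_level :: "real \<Rightarrow> (real \<Rightarrow> real) \<Rightarrow> ereal" where
  "x_level \<nu> \<phi> = inf_ess (superlevel \<phi> \<nu>)"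

text \<open>
  Meaningful only if \<open>superlevel \<phi> \<nu>\<close> has positive measure; then \<open>x_level \<nu> \<phi>\<close> is finite, so the
  conversion to a real number loses nothing.
\<close>

definition y_level :: "real \<Rightarrow> (real \<Rightarrow> real) \<Rightarrow> real" where
  "y_level \<nu> \<phi> =
     (let x = real_of_ereal (x_level \<nu> \<phi>)
      in x - measure lebesgue (hollows_below \<infinity> \<phi> \<inter> {0..x}))"

definition S_level :: "real \<Rightarrow> (real \<Rightarrow> real) \<Rightarrow> real set" where
  "S_level \<nu> \<phi> =
     (let m = emeasure lebesgue (superlevel \<phi> \<nu>); y = y_level \<nu> \<phi>
      in if m = 0 then {} else if m = \<infinity> then {y..} else {y..y + enn2real m})"

text \<open>
  The values are extended, since the supremum can be infinite (on a null set if \<open>\<phi>\<close> is in \<open>L\<^sup>p\<close>).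
  In \<open>ennreal\<close> the supremum of the empty set is \<open>0\<close>.
\<close>

definition tamping :: "(real \<Rightarrow> real) \<Rightarrow> real \<Rightarrow> ennreal" where
  "tamping \<phi> x = Sup {ennreal \<nu> | \<nu>. 0 < \<nu> \<and> x \<in> S_level \<nu> \<phi>}"

end

theory Submission
  imports Defs "HOL-Library.Diagonal_Subsequence"
begin

text \<open>
  The sets \<open>S_level \<nu> \<phi>\<close> are nested intervals with the measures of the superlevel sets of \<open>\<phi>\<close>, so
  tamping does not increase the \<open>L\<^sup>p\<close> norm and produces functions whose superlevel sets are intervals.
  Endpoints of intervals can be extracted to converge, and a diagonal sequence over rational levels
  converges pointwise off a countable set. Pointwise convergence together with boundedness in \<open>L\<^sup>p\<close>
  implies weak convergence.
\<close>

subsection \<open>Weak convergence from pointwise convergence\<close>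

text \<open>Weak convergence is tested against every bounded functional on \<open>L^p\<close>, not
  against functions of a dual exponent. The passage from pointwise convergence is therefore made for
  an abstract \<open>T\<close>, by comparing two growth rates, \<open>k\<close> and
  \<open>k powr (1 / p)\<close>, which differ because \<open>p > 1\<close>. The geometric core is
  the nestedness of the level intervals. When the level rises, the left endpoint moves right by
  exactly the non-hollow length between the two essential infima. That length is already part of the
  mass of the lower superlevel set, so the right endpoint cannot overtake the old one. Nestedness
  makes each strict superlevel set of a tamping an increasing union of level intervals, for every
  level and not just almost every one; convexity, measurability and the measure bound all come from
  this identity. Tampings take values in \<open>ennreal\<close>. Selection takes place there, where
  limits may be infinite, and finiteness almost everywhere is recovered from the norm bound before
  passing to real functions.\<close>

lemma abs_add_powr_le:
  fixes a b p :: real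
  assumes "0 \<le> p" "\<bar>a\<bar> \<le> \<bar>b\<bar>"
  shows "\<bar>a + b\<bar> powr p \<le> 2 powr p * \<bar>b\<bar> powr p"
proof -
  have "\<bar>a + b\<bar> powr p \<le> (2 * \<bar>b\<bar>) powr p"
    using assms by (intro powr_mono2) auto
  then show ?thesis by (simp add: powr_mult)
qed

lemma abs_add_powr_le_sum:
  fixes a b p :: real
  assumes "0 \<le> p"
  shows "\<bar>a + b\<bar> powr p \<le> 2 powr p * (\<bar>a\<bar> powr p + \<bar>b\<bar> powr p)"
proof -
  have "0 \<le> 2 powr p * \<bar>a\<bar> powr p" "0 \<le> 2 powr p * \<bar>b\<bar> powr p" by auto
  then show ?thesis
    using abs_add_powr_le[OF assms, of a b] abs_add_powr_le[OF assms, of b a]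
    unfolding distrib_left add.commute[of b a] by linarith
qed

lemma LpD:
  assumes "f \<in> Lp p M"
  shows "f \<in> borel_measurable M" "integrable M (\<lambda>x. \<bar>f x\<bar> powr p)"
  using assms by (auto simp: Lp_def)

lemma Lp_add:
  assumes "0 \<le> p" "f \<in> Lp p M" "g \<in> Lp p M"
  shows "(\<lambda>x. f x + g x) \<in> Lp p M"
proof -
  note [measurable] = LpD(1)[OF assms(2)] LpD(1)[OF assms(3)]
  have "integrable M (\<lambda>x. \<bar>f x + g x\<bar> powr p)"
  proof (rule Bochner_Integration.integrable_bound)
    show "integrable M (\<lambda>x. 2 powr p * (\<bar>f x\<bar> powr p + \<bar>g x\<bar> powr p))"
      using LpD(2)[OF assms(2)] LpD(2)[OF assms(3)] by auto
    show "AE x in M. norm (\<bar>f x + g x\<bar> powr p) \<le> norm (2 powr p * (\<bar>f x\<bar> powr p + \<bar>g x\<bar> powr p))"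
      using abs_add_powr_le_sum[OF assms(1)] by (auto intro!: AE_I2)
  qed measurable
  then show ?thesis by (auto simp: Lp_def)
qed

lemma Lp_cmult:
  assumes "f \<in> Lp p M"
  shows "(\<lambda>x. c * f x) \<in> Lp p M"
  using LpD[OF assms] by (auto simp: Lp_def abs_mult powr_mult)

lemma zero_in_Lp: "(\<lambda>x. 0) \<in> Lp p M"
  by (auto simp: Lp_def)

text \<open>The integral of \<open>v\<close> enters with coefficient 1, so the bound can be iterated
  with a fixed cost per added term. The crude estimate \<open>abs_add_powr_le_sum\<close> would
  multiply the accumulated integral by \<open>2 powr p\<close> each time.\<close>

lemma integral_powr_add_null_le:
  fixes u :: "nat \<Rightarrow> 'a \<Rightarrow> real"
  assumes p: "0 < p" and v: "v \<in> Lp p M" and u: "\<And>n. u n \<in> Lp p M"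
    and lim: "AE x in M. (\<lambda>n. u n x) \<longlonglongrightarrow> 0"
    and K: "\<And>n. (\<integral>x. \<bar>u n x\<bar> powr p \<partial>M) \<le> K"
  shows "\<forall>\<^sub>F n in sequentially.
    (\<integral>x. \<bar>v x + u n x\<bar> powr p \<partial>M) \<le> (\<integral>x. \<bar>v x\<bar> powr p \<partial>M) + (2 powr p * K + 1)"
proof -
  \<comment> \<open>\<open>W\<close> is the excess over the desired pointwise bound. It vanishes
    where \<open>u n\<close> dominates \<open>v\<close>, is at most
    \<open>2 powr p * \<bar>v x\<bar> powr p\<close> elsewhere, and tends to 0 almost everywhere. By
    dominated convergence its integral is eventually below 1, whence the summand 1.\<close>
  define W where "W n x = max 0 (\<bar>v x + u n x\<bar> powr p - \<bar>v x\<bar> powr p - 2 powr p * \<bar>u n x\<bar> powr p)" for n x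
  note [measurable] = LpD(1)[OF v] LpD(1)[OF u]
  have [measurable]: "W n \<in> borel_measurable M" for n
    unfolding W_def by measurable
  have W_le: "norm (W n x) \<le> 2 powr p * \<bar>v x\<bar> powr p" for n x
  proof (cases "\<bar>v x\<bar> \<le> \<bar>u n x\<bar>")
    case True
    have "0 \<le> \<bar>v x\<bar> powr p" by simp
    with abs_add_powr_le[OF _ True, of p] p have "W n x = 0"
      unfolding W_def by (intro max_absorb1) linarith
    then show ?thesis by simp
  next
    case False
    have "0 \<le> \<bar>v x\<bar> powr p" "0 \<le> 2 powr p * \<bar>u n x\<bar> powr p" by auto
    moreover have "\<bar>v x + u n x\<bar> powr p \<le> 2 powr p * \<bar>v x\<bar> powr p"
      using abs_add_powr_le[of p "u n x" "v x"] p False by (simp add: add.commute)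
    ultimately show ?thesis
      unfolding W_def real_norm_def by (smt (verit) mult_nonneg_nonneg powr_ge_zero)
  qed
  have int_dom: "integrable M (\<lambda>x. 2 powr p * \<bar>v x\<bar> powr p)"
    using LpD(2)[OF v] by auto
  have "(\<lambda>n. \<integral>x. W n x \<partial>M) \<longlonglongrightarrow> (\<integral>x. 0 \<partial>M)"
  proof (rule integral_dominated_convergence[OF _ _ int_dom])
    show "AE x in M. (\<lambda>n. W n x) \<longlonglongrightarrow> 0"
      using lim
    proof eventually_elim
      case (elim x)
      have "(\<lambda>n. W n x) \<longlonglongrightarrow> max 0 (\<bar>v x + 0\<bar> powr p - \<bar>v x\<bar> powr p - 2 powr p * \<bar>0\<bar> powr p)"
        unfolding W_def using p
        by (intro tendsto_intros tendsto_powr' elim) auto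
      then show ?case using p by simp
    qed
  qed (use W_le in auto)
  then have "\<forall>\<^sub>F n in sequentially. (\<integral>x. W n x \<partial>M) < 1"
    by (intro order_tendstoD(2)) auto
  then show ?thesis
  proof eventually_elim
    case (elim n)
    have intW: "integrable M (W n)"
      using W_le by (intro Bochner_Integration.integrable_bound[OF int_dom]) (auto intro!: AE_I2)
    note int_vu = LpD(2)[OF v] LpD(2)[OF u[of n]] intW
    have "(\<integral>x. \<bar>v x + u n x\<bar> powr p \<partial>M) \<le> (\<integral>x. \<bar>v x\<bar> powr p + 2 powr p * \<bar>u n x\<bar> powr p + W n x \<partial>M)"
    proof (rule integral_mono)
      show "integrable M (\<lambda>x. \<bar>v x + u n x\<bar> powr p)"
        using LpD(2)[OF Lp_add[OF _ v u[of n]]] p by simp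
      show "\<bar>v x + u n x\<bar> powr p \<le> \<bar>v x\<bar> powr p + 2 powr p * \<bar>u n x\<bar> powr p + W n x" for x
        by (simp add: W_def)
    qed (use int_vu in auto)
    also have "\<dots> = (\<integral>x. \<bar>v x\<bar> powr p \<partial>M) + 2 powr p * (\<integral>x. \<bar>u n x\<bar> powr p \<partial>M) + (\<integral>x. W n x \<partial>M)"
      using int_vu by simp
    also have "\<dots> \<le> (\<integral>x. \<bar>v x\<bar> powr p \<partial>M) + 2 powr p * K + 1"
      using elim K[of n] by (intro add_mono mult_left_mono) auto
    finally show ?case by simp
  qed
qed

text \<open>
  A Banach--Saks argument: if \<open>T (u n)\<close> stayed away from 0, sums of \<open>k\<close> sparse terms would have
  norm \<open>O(k powr (1/p))\<close> but \<open>T\<close>-value at least \<open>k * \<epsilon>\<close>.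
\<close>

lemma Lp_dual_tendsto_zero:
  fixes u :: "nat \<Rightarrow> 'a \<Rightarrow> real"
  assumes p: "1 < p" and u: "\<And>n. u n \<in> Lp p M"
    and lim: "AE x in M. (\<lambda>n. u n x) \<longlonglongrightarrow> 0"
    and K: "\<And>n. (\<integral>x. \<bar>u n x\<bar> powr p \<partial>M) \<le> K"
    and T: "T \<in> Lp_dual p M"
  shows "(\<lambda>n. T (u n)) \<longlonglongrightarrow> 0"
proof (rule ccontr)
  assume "\<not> ?thesis"
  then have "\<exists>e>0. \<exists>\<^sub>F n in sequentially. e \<le> \<bar>T (u n)\<bar>"
    by (simp add: tendsto_iff frequently_def not_le)
  then obtain e where e: "0 < e" "\<exists>\<^sub>F n in sequentially. e \<le> \<bar>T (u n)\<bar>" by blast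
  have T_add: "T (\<lambda>x. f x + g x) = T f + T g" if "f \<in> Lp p M" "g \<in> Lp p M" for f g
    using T that by (simp add: Lp_dual_def)
  have T_cmult: "T (\<lambda>x. c * f x) = c * T f" if "f \<in> Lp p M" for c f
    using T that by (simp add: Lp_dual_def)
  obtain C where C: "\<And>f. f \<in> Lp p M \<Longrightarrow> \<bar>T f\<bar> \<le> C * Lp_norm p M f"
    using T unfolding Lp_dual_def mem_Collect_eq by metis
  \<comment> \<open>The signs make all values of \<open>T\<close> non-negative, so that they add up
    without cancellation.\<close>
  define u' where "u' n x = sgn (T (u n)) * u n x" for n x
  have u': "u' n \<in> Lp p M" for n
    unfolding u'_def by (intro Lp_cmult u)
  have T_u': "T (u' n) = \<bar>T (u n)\<bar>" for n
    unfolding u'_def T_cmult[OF u] by (simp add: abs_sgn mult.commute)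
  have u'_le: "\<bar>u' n x\<bar> \<le> \<bar>u n x\<bar>" for n x
    by (auto simp: u'_def abs_mult abs_sgn_eq)
  have lim': "AE x in M. (\<lambda>n. u' n x) \<longlonglongrightarrow> 0"
    using lim
  proof eventually_elim
    case (elim x)
    then have "(\<lambda>n. \<bar>u n x\<bar>) \<longlonglongrightarrow> 0" by (simp add: tendsto_rabs_zero_iff)
    then show ?case by (rule Lim_null_comparison[rotated]) (use u'_le in auto)
  qed
  have K': "(\<integral>x. \<bar>u' n x\<bar> powr p \<partial>M) \<le> K" for n
  proof -
    have "(\<integral>x. \<bar>u' n x\<bar> powr p \<partial>M) \<le> (\<integral>x. \<bar>u n x\<bar> powr p \<partial>M)"
      using p u'_le by (intro integral_mono LpD(2) u u' powr_mono2) auto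
    with K[of n] show ?thesis by simp
  qed
  define L where "L = 2 powr p * K + 1"
  have "0 \<le> (\<integral>x. \<bar>u 0 x\<bar> powr p \<partial>M)" by simp
  with K[of 0] have "0 \<le> K" by linarith
  then have L: "0 < L" by (auto simp: L_def intro!: add_nonneg_pos)
  have sums: "\<exists>v\<in>Lp p M. real k * e \<le> T v \<and> (\<integral>x. \<bar>v x\<bar> powr p \<partial>M) \<le> real k * L" for k
  proof (induction k)
    case 0
    have "T (\<lambda>x. 0) = 0" using T_cmult[OF zero_in_Lp, of 0] by simp
    then show ?case by (intro bexI[OF _ zero_in_Lp]) simp
  next
    case (Suc k)
    then obtain v where v: "v \<in> Lp p M" "real k * e \<le> T v" "(\<integral>x. \<bar>v x\<bar> powr p \<partial>M) \<le> real k * L"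
      by blast
    have "\<forall>\<^sub>F n in sequentially. (\<integral>x. \<bar>v x + u' n x\<bar> powr p \<partial>M) \<le> (\<integral>x. \<bar>v x\<bar> powr p \<partial>M) + L"
      unfolding L_def using p by (intro integral_powr_add_null_le v(1) u' lim' K') auto
    \<comment> \<open>The new term is chosen after the partial sum \<open>v\<close>: among the
      frequent indices where \<open>T\<close> is large, one is late enough for the eventual norm
      estimate.\<close>
    from frequently_ex[OF frequently_eventually_frequently[OF e(2) this]]
    obtain n where n: "e \<le> \<bar>T (u n)\<bar>"
      "(\<integral>x. \<bar>v x + u' n x\<bar> powr p \<partial>M) \<le> (\<integral>x. \<bar>v x\<bar> powr p \<partial>M) + L"
      by blast
    show ?case
    proof (intro bexI conjI)
      show "(\<lambda>x. v x + u' n x) \<in> Lp p M" using p v(1) u' by (intro Lp_add) auto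
      show "real (Suc k) * e \<le> T (\<lambda>x. v x + u' n x)"
        using T_add[OF v(1) u'] T_u' n(1) v(2) by (simp add: algebra_simps)
      show "(\<integral>x. \<bar>v x + u' n x\<bar> powr p \<partial>M) \<le> real (Suc k) * L"
        using n(2) v(3) by (simp add: algebra_simps)
    qed
  qed
  have bound: "real k * e \<le> (\<bar>C\<bar> * L powr (1 / p)) * real k powr (1 / p)" for k
  proof -
    obtain v where v: "v \<in> Lp p M" "real k * e \<le> T v" "(\<integral>x. \<bar>v x\<bar> powr p \<partial>M) \<le> real k * L"
      using sums by blast
    have "T v \<le> C * Lp_norm p M v" using C[OF v(1)] by simp
    also have "\<dots> \<le> \<bar>C\<bar> * Lp_norm p M v" by (intro mult_right_mono) (auto simp: Lp_norm_def)
    also have "\<dots> \<le> \<bar>C\<bar> * (real k * L) powr (1 / p)"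
      unfolding Lp_norm_def using v(3) p by (intro mult_left_mono powr_mono2) auto
    also have "\<dots> = (\<bar>C\<bar> * L powr (1 / p)) * real k powr (1 / p)"
      using L by (simp add: powr_mult)
    finally show ?thesis using v(2) by simp
  qed
  define D where "D = \<bar>C\<bar> * L powr (1 / p)"
  \<comment> \<open>Dividing the bound by \<open>k\<close> leaves the exponent
    \<open>1 / p - 1\<close>, which is negative because \<open>p > 1\<close>.\<close>
  have "(\<lambda>k. D * real k powr (1 / p - 1)) \<longlonglongrightarrow> D * 0"
    using p by (intro tendsto_intros tendsto_neg_powr filterlim_real_sequentially) auto
  then have "\<forall>\<^sub>F k in sequentially. D * real k powr (1 / p - 1) < e"
    using e(1) by (intro order_tendstoD(2)) auto
  from eventually_happens'[OF sequentially_bot eventually_conj[OF eventually_gt_at_top[of 0] this]]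
  obtain k where k: "0 < k" "D * real k powr (1 / p - 1) < e" by blast
  have "D * real k powr (1 / p) = D * real k powr (1 / p - 1) * real k"
    using k(1) by (simp add: powr_diff)
  also have "\<dots> < e * real k" using k by simp
  finally show False using bound[of k] by (simp add: D_def mult.commute)
qed

text \<open>Fatou's lemma puts \<open>g\<close> into \<open>L^p\<close>. The differences
  \<open>f n - g\<close> are then bounded in \<open>L^p\<close> and tend to 0 almost everywhere, so
  \<open>Lp_dual_tendsto_zero\<close> applies to them.\<close>

lemma weakly_converges_LpI_AE:
  fixes f :: "nat \<Rightarrow> 'a \<Rightarrow> real"
  assumes p: "1 < p" and f: "\<And>n. f n \<in> Lp p M" and g: "g \<in> borel_measurable M"
    and lim: "AE x in M. (\<lambda>n. f n x) \<longlonglongrightarrow> g x"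
    and K: "\<And>n. (\<integral>x. \<bar>f n x\<bar> powr p \<partial>M) \<le> K"
  shows "weakly_converges_Lp p M f g"
proof -
  note [measurable] = g LpD(1)[OF f]
  have g_Lp: "g \<in> Lp p M"
  proof -
    have "(\<integral>\<^sup>+x. ennreal (\<bar>g x\<bar> powr p) \<partial>M) \<le> (\<integral>\<^sup>+x. liminf (\<lambda>n. ennreal (\<bar>f n x\<bar> powr p)) \<partial>M)"
    proof (rule nn_integral_mono_AE)
      show "AE x in M. ennreal (\<bar>g x\<bar> powr p) \<le> liminf (\<lambda>n. ennreal (\<bar>f n x\<bar> powr p))"
        using lim
      proof eventually_elim
        case (elim x)
        have "(\<lambda>n. ennreal (\<bar>f n x\<bar> powr p)) \<longlonglongrightarrow> ennreal (\<bar>g x\<bar> powr p)"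
          using p by (intro tendsto_ennrealI tendsto_powr' tendsto_intros elim) auto
        from lim_imp_Liminf[OF _ this] show ?case by simp
      qed
    qed
    also have "\<dots> \<le> liminf (\<lambda>n. \<integral>\<^sup>+x. ennreal (\<bar>f n x\<bar> powr p) \<partial>M)"
      by (rule nn_integral_liminf) measurable
    also have "\<dots> \<le> liminf (\<lambda>n. ennreal K)"
      using K LpD(2)[OF f] by (intro Liminf_mono always_eventually allI)
        (simp add: nn_integral_eq_integral ennreal_leI)
    also have "\<dots> < \<infinity>" by (simp add: Liminf_const)
    finally show ?thesis by (auto simp: Lp_def intro!: integrableI_nonneg)
  qed
  have "(\<lambda>n. T (f n)) \<longlonglongrightarrow> T g" if T: "T \<in> Lp_dual p M" for T
  proof -
    \<comment> \<open>The difference is written with the factor \<open>-1\<close> so that additivity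
      and homogeneity of \<open>T\<close> apply literally.\<close>
    define u where "u n x = f n x + (-1) * g x" for n x
    have u: "u n \<in> Lp p M" for n
      unfolding u_def using p f g_Lp by (intro Lp_add Lp_cmult) auto
    have "(\<lambda>n. T (u n)) \<longlonglongrightarrow> 0"
    proof (rule Lp_dual_tendsto_zero[OF p u _ _ T])
      show "AE x in M. (\<lambda>n. u n x) \<longlonglongrightarrow> 0"
        using lim by eventually_elim (simp add: u_def LIM_zero)
      show "(\<integral>x. \<bar>u n x\<bar> powr p \<partial>M) \<le> 2 powr p * (K + (\<integral>x. \<bar>g x\<bar> powr p \<partial>M))" for n
      proof -
        have "(\<integral>x. \<bar>u n x\<bar> powr p \<partial>M) \<le> (\<integral>x. 2 powr p * (\<bar>f n x\<bar> powr p + \<bar>g x\<bar> powr p) \<partial>M)"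
          using LpD(2)[OF u] LpD(2)[OF f[of n]] LpD(2)[OF g_Lp] p
            abs_add_powr_le_sum[of p "f n x" "(-1) * g x" for x]
          by (intro integral_mono) (auto simp: u_def)
        also have "\<dots> = 2 powr p * ((\<integral>x. \<bar>f n x\<bar> powr p \<partial>M) + (\<integral>x. \<bar>g x\<bar> powr p \<partial>M))"
          using LpD(2)[OF f[of n]] LpD(2)[OF g_Lp] by simp
        finally show ?thesis using K[of n] by (smt (verit) mult_left_mono powr_ge_zero)
      qed
    qed
    moreover have "T (u n) = T (f n) - T g" for n
    proof -
      have "\<forall>f\<in>Lp p M. \<forall>g\<in>Lp p M. T (\<lambda>x. f x + g x) = T f + T g"
        "\<forall>c. \<forall>f\<in>Lp p M. T (\<lambda>x. c * f x) = c * T f"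
        using T by (simp_all add: Lp_dual_def)
      from bspec[OF bspec[OF this(1) f[of n]] Lp_cmult[OF g_Lp, of "-1"]] bspec[OF spec[OF this(2), of "-1"] g_Lp]
      show ?thesis by (simp add: u_def[abs_def])
    qed
    ultimately show ?thesis by (simp add: LIM_zero_iff)
  qed
  with f g_Lp show ?thesis by (auto simp: weakly_converges_Lp_def)
qed

subsection \<open>Layer cake comparison\<close>

lemma sigma_finite_half_line: "sigma_finite_measure half_line"
proof (rule sigma_finite_measure_restrict_space)
  show "sigma_finite_measure lebesgue"
  proof (unfold_locales, intro exI conjI)
    show "countable (range (\<lambda>n. cball (0::'a) (real n)))" by simp
    show "range (\<lambda>n. cball (0::'a) (real n)) \<subseteq> sets lebesgue" by auto
    show "\<Union> (range (\<lambda>n. cball (0::'a) (real n))) = space lebesgue"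
      using real_arch_simple by (auto simp: mem_cball)
    show "\<forall>a\<in>range (\<lambda>n. cball (0::'a) (real n)). emeasure lebesgue a \<noteq> \<infinity>"
      using lmeasurable_cball[of "0::'a"] by (auto simp: fmeasurable_def less_top)
  qed
qed simp

text \<open>The value \<open>f x\<close> is the length of \<open>{0..<f x}\<close>; Tonelli's
  theorem exchanges the two integrals.\<close>

lemma (in sigma_finite_measure) nn_integral_layer_cake:
  fixes f :: "'a \<Rightarrow> real"
  assumes [measurable]: "f \<in> borel_measurable M" and "\<And>x. 0 \<le> f x"
  shows "(\<integral>\<^sup>+x. ennreal (f x) \<partial>M) = (\<integral>\<^sup>+t. emeasure M {x \<in> space M. t < f x} * indicator {0..} t \<partial>lborel)"
proof -
  interpret pair_sigma_finite M lborel ..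
  have "(\<integral>\<^sup>+x. ennreal (f x) \<partial>M) = (\<integral>\<^sup>+x. \<integral>\<^sup>+t. indicator {t. 0 \<le> t \<and> t < f x} t \<partial>lborel \<partial>M)"
  proof (intro nn_integral_cong)
    fix x
    have "{t. 0 \<le> t \<and> t < f x} = {0..<f x}" by auto
    then show "ennreal (f x) = (\<integral>\<^sup>+t. indicator {t. 0 \<le> t \<and> t < f x} t \<partial>lborel)"
      using assms(2)[of x] by simp
  qed
  also have "\<dots> = (\<integral>\<^sup>+t. \<integral>\<^sup>+x. indicator {t. 0 \<le> t \<and> t < f x} t \<partial>M \<partial>lborel)"
    by (rule Fubini'[symmetric]) (simp add: indicator_def, measurable)
  also have "\<dots> = (\<integral>\<^sup>+t. emeasure M {x \<in> space M. t < f x} * indicator {0..} t \<partial>lborel)"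
  proof (intro nn_integral_cong)
    fix t
    have "(\<integral>\<^sup>+x. indicator {t. 0 \<le> t \<and> t < f x} t \<partial>M) =
        (\<integral>\<^sup>+x. indicator {0..} t * indicator {x \<in> space M. t < f x} x \<partial>M)"
      by (intro nn_integral_cong) (auto simp: indicator_def)
    then show "(\<integral>\<^sup>+x. indicator {t. 0 \<le> t \<and> t < f x} t \<partial>M) =
        emeasure M {x \<in> space M. t < f x} * indicator {0..} t"
      by (simp add: nn_integral_cmult mult.commute)
  qed
  finally show ?thesis .
qed

text \<open>The layer cake formula is applied to the \<open>p\<close>-th powers themselves: their
  superlevel set above \<open>t\<close> is that of the function above \<open>t powr (1 / p)\<close>,
  so no change of variables occurs.\<close>

lemma (in sigma_finite_measure) nn_integral_powr_le_of_distribution_le: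
  fixes f g :: "'a \<Rightarrow> real"
  assumes p: "0 < p" and [measurable]: "f \<in> borel_measurable M" "g \<in> borel_measurable M"
    and le: "\<And>c. 0 \<le> c \<Longrightarrow>
      emeasure M {x \<in> space M. c < \<bar>f x\<bar>} \<le> emeasure M {x \<in> space M. c < \<bar>g x\<bar>}"
  shows "(\<integral>\<^sup>+x. ennreal (\<bar>f x\<bar> powr p) \<partial>M) \<le> (\<integral>\<^sup>+x. ennreal (\<bar>g x\<bar> powr p) \<partial>M)"
proof -
  have powr_iff: "t < \<bar>a\<bar> powr p \<longleftrightarrow> t powr (1 / p) < \<bar>a\<bar>" if "0 \<le> t" for t a :: real
  proof -
    have "t < \<bar>a\<bar> powr p \<longleftrightarrow> t powr (1 / p) < (\<bar>a\<bar> powr p) powr (1 / p)"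
      using p that powr_less_mono2[of "1 / p" t "\<bar>a\<bar> powr p"]
        powr_mono2[of "1 / p" "\<bar>a\<bar> powr p" t] by fastforce
    then show ?thesis using p by (simp add: powr_powr)
  qed
  show ?thesis
    by (subst (1 2) nn_integral_layer_cake)
      (use le in \<open>auto intro!: nn_integral_mono simp: indicator_def powr_iff\<close>)
qed

subsection \<open>Essential hulls and the level intervals\<close>

text \<open>A convex set differs from its open interior by a part of its frontier, which is
  negligible.\<close>

lemma convex_real_sets_lebesgue:
  fixes S :: "real set"
  assumes "convex S"
  shows "S \<in> sets lebesgue"
proof -
  have "S - interior S \<subseteq> frontier S"
    using closure_subset[of S] by (auto simp: frontier_def)
  then have "negligible (S - interior S)"
    using negligible_convex_frontier[OF assms] negligible_subset by blast
  then have "interior S \<union> (S - interior S) \<in> sets lebesgue"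
    by (intro sets.Un) (auto simp: negligible_imp_sets)
  then show ?thesis using interior_subset[of S] by (simp add: Un_absorb1)
qed

lemma sets_superlevel:
  assumes "\<phi> \<in> borel_measurable half_line"
  shows "superlevel \<phi> l \<in> sets lebesgue"
proof -
  have "{x \<in> space half_line. l \<le> \<phi> x} \<in> sets half_line"
    using assms by measurable
  then show ?thesis
    by (auto simp: superlevel_def space_restrict_space sets_restrict_space_iff)
qed

lemma superlevel_antimono: "l \<le> l' \<Longrightarrow> superlevel \<phi> l' \<subseteq> superlevel \<phi> l"
  by (auto simp: superlevel_def)

lemma convex_conv_ess: "convex (conv_ess A)"
  unfolding conv_ess_def by (intro convex_Inter) auto

text \<open>If \<open>B\<close> competes for \<open>A'\<close>, then \<open>B \<inter> A\<close>
  competes for \<open>A\<close>, and its hull lies in that of \<open>B\<close>.\<close>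

lemma conv_ess_mono:
  assumes "A \<subseteq> A'"
  shows "conv_ess A \<subseteq> conv_ess A'"
  unfolding conv_ess_def
proof (intro Inter_greatest, clarify)
  fix x B assume x: "x \<in> \<Inter> {convex hull B |B. B \<subseteq> {0..} \<and> sym_diff A B \<in> null_sets lebesgue}"
    and B: "B \<subseteq> {0..}" "sym_diff A' B \<in> null_sets lebesgue"
  have "negligible (sym_diff A (B \<inter> A))"
    using B(2) assms by (auto simp: negligible_iff_null_sets[symmetric] elim!: negligible_subset)
  then have "x \<in> convex hull (B \<inter> A)"
    using x B(1) unfolding negligible_iff_null_sets by (auto dest!: spec[of _ "convex hull (B \<inter> A)"])
  then show "x \<in> convex hull B"
    using hull_mono[of "B \<inter> A" B convex] by auto
qed

lemma conv_ess_subset: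
  assumes "A \<subseteq> {0..}"
  shows "conv_ess A \<subseteq> {0..}"
proof -
  have "conv_ess A \<subseteq> convex hull A"
    using assms unfolding conv_ess_def by (intro Inter_lower) auto
  also have "\<dots> \<subseteq> {0..}" using assms by (intro hull_minimal) auto
  finally show ?thesis .
qed

text \<open>Mass of \<open>A\<close> on a side of \<open>z\<close> cannot be removed by a null
  modification, so every competitor has points on both sides of \<open>z\<close>.\<close>

lemma mem_conv_ess:
  assumes "\<not> negligible (A \<inter> {..z})" "\<not> negligible (A \<inter> {z..})"
  shows "z \<in> conv_ess A"
  unfolding conv_ess_def
proof (intro InterI, clarify)
  fix B assume "sym_diff A B \<in> null_sets lebesgue"
  then have null: "negligible (A - B)"
    by (auto simp: negligible_iff_null_sets[symmetric] elim!: negligible_subset)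
  have "\<not> A \<inter> {..z} \<subseteq> A - B" "\<not> A \<inter> {z..} \<subseteq> A - B"
    using assms null negligible_subset by blast+
  then obtain a b where "a \<in> B" "a \<le> z" "b \<in> B" "z \<le> b" by auto
  then have "z \<in> closed_segment a b" by (simp add: closed_segment_eq_real_ivl)
  then show "z \<in> convex hull B"
    using \<open>a \<in> B\<close> \<open>b \<in> B\<close> by (meson closed_segment_subset_convex_hull hull_inc subsetD)
qed

text \<open>Rational levels suffice: a point \<open>z\<close> hollow at level \<open>l\<close>
  satisfies \<open>\<phi> z < l\<close>, and it stays hollow at any \<open>q\<close> strictly
  between, since the hull grows as the level falls.\<close>

lemma sets_hollows_below_infinity:
  assumes "\<phi> \<in> borel_measurable half_line"
  shows "hollows_below \<infinity> \<phi> \<in> sets lebesgue"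
proof -
  have "hollows_below \<infinity> \<phi> = (\<Union>q\<in>\<rat>. hollows (superlevel \<phi> q))"
  proof (intro equalityI subsetI)
    fix z assume "z \<in> hollows_below \<infinity> \<phi>"
    then obtain l where l: "z \<in> conv_ess (superlevel \<phi> l)" "z \<notin> superlevel \<phi> l"
      by (auto simp: hollows_below_def hollows_def)
    have "z \<in> {0..}"
      using l(1) conv_ess_subset[of "superlevel \<phi> l"] by (auto simp: superlevel_def)
    with l(2) have "\<phi> z < l" by (auto simp: superlevel_def)
    then obtain q where q: "q \<in> \<rat>" "\<phi> z < q" "q < l" using Rats_dense_in_real by blast
    have "z \<in> conv_ess (superlevel \<phi> q)"
      using l(1) q conv_ess_mono[OF superlevel_antimono[of q l \<phi>]] by auto
    with q show "z \<in> (\<Union>q\<in>\<rat>. hollows (superlevel \<phi> q))"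
      by (auto simp: hollows_def superlevel_def)
  qed (auto simp: hollows_below_def)
  also have "\<dots> \<in> sets lebesgue"
    unfolding hollows_def
    by (intro sets.countable_UN'' countable_rat sets.Diff convex_real_sets_lebesgue
        convex_conv_ess sets_superlevel assms)
  finally show ?thesis .
qed

section \<open>Essential infima\<close>

lemma inf_ess_nonneg: "0 \<le> inf_ess A"
proof -
  have "ereal 0 \<le> inf_ess A"
    unfolding inf_ess_def
  proof (intro Sup_upper CollectI exI conjI refl)
    have "A \<inter> {0..0} \<in> null_sets lebesgue"
      using negligible_subset[of "{0::real}" "A \<inter> {0..0}"] by (auto simp: negligible_iff_null_sets)
    then show "emeasure lebesgue (A \<inter> {0..0::real}) = 0" by auto
  qed auto
  then show ?thesis by (simp add: zero_ereal_def)
qed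

lemma emeasure_less_inf_ess:
  assumes A: "A \<in> sets lebesgue" and "ereal z < inf_ess A"
  shows "emeasure lebesgue (A \<inter> {0..z}) = 0"
proof -
  obtain a where "z < a" "emeasure lebesgue (A \<inter> {0..a}) = 0"
    using assms(2) by (auto simp: inf_ess_def less_Sup_iff)
  moreover have "emeasure lebesgue (A \<inter> {0..z}) \<le> emeasure lebesgue (A \<inter> {0..a})"
    using A \<open>z < a\<close> by (intro emeasure_mono) auto
  ultimately show ?thesis by simp
qed

lemma emeasure_greater_inf_ess:
  assumes "inf_ess A < ereal z"
  shows "emeasure lebesgue (A \<inter> {0..z}) \<noteq> 0"
proof
  assume *: "emeasure lebesgue (A \<inter> {0..z}) = 0"
  have "0 \<le> z" using inf_ess_nonneg[of A] assms by (metis ereal_less_eq(5) less_imp_le order_trans)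
  with * have "ereal z \<le> inf_ess A" unfolding inf_ess_def by (intro Sup_upper) auto
  with assms show False by simp
qed

text \<open>With an infinite infimum, \<open>A\<close> would be the union of the null sets
  \<open>A \<inter> {0..real n}\<close>. The part below \<open>x\<close> is null by the same
  exhaustion, along \<open>x - 1 / Suc n\<close>.\<close>

lemma inf_ess_real:
  assumes A: "A \<in> sets lebesgue" "A \<subseteq> {0..}" "emeasure lebesgue A \<noteq> 0"
  obtains x where "inf_ess A = ereal x" "0 \<le> x" "negligible (A \<inter> {0..<x})"
proof -
  have "inf_ess A \<noteq> \<infinity>"
  proof
    assume "inf_ess A = \<infinity>"
    then have "(\<Union>n::nat. A \<inter> {0..real n}) \<in> null_sets lebesgue"
      using emeasure_less_inf_ess[OF A(1)] A(1) by (intro null_sets_UN null_setsI) auto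
    also have "(\<Union>n::nat. A \<inter> {0..real n}) = A"
    proof (intro equalityI subsetI)
      fix z assume "z \<in> A"
      moreover obtain n :: nat where "z \<le> real n" using real_arch_simple by blast
      ultimately show "z \<in> (\<Union>n::nat. A \<inter> {0..real n})" using A(2) by auto
    qed auto
    finally show False using A(3) by auto
  qed
  moreover have "inf_ess A \<noteq> -\<infinity>" using inf_ess_nonneg[of A] by auto
  ultimately obtain x where x: "inf_ess A = ereal x" by (cases "inf_ess A") auto
  have "(\<Union>n::nat. A \<inter> {0..x - 1 / Suc n}) \<in> null_sets lebesgue"
    using emeasure_less_inf_ess[OF A(1)] A(1) x by (intro null_sets_UN null_setsI) auto
  moreover have "A \<inter> {0..<x} \<subseteq> (\<Union>n::nat. A \<inter> {0..x - 1 / Suc n})"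
  proof
    fix z assume z: "z \<in> A \<inter> {0..<x}"
    then obtain n :: nat where "1 / Suc n < x - z"
      using nat_approx_posE[of "x - z"] by auto
    with z show "z \<in> (\<Union>n::nat. A \<inter> {0..x - 1 / Suc n})"
      by (intro UN_I[of n]) auto
  qed
  ultimately have "negligible (A \<inter> {0..<x})"
    unfolding negligible_iff_null_sets[symmetric] by (rule negligible_subset)
  then show ?thesis using that x inf_ess_nonneg[of A] by auto
qed

lemma inf_ess_antimono:
  assumes "A \<in> sets lebesgue" "B \<subseteq> A"
  shows "inf_ess A \<le> inf_ess B"
  unfolding inf_ess_def
proof (intro Sup_subset_mono subsetI, clarify)
  fix a :: real assume a: "0 \<le> a" "emeasure lebesgue (A \<inter> {0..a}) = 0"
  have "emeasure lebesgue (B \<inter> {0..a}) \<le> emeasure lebesgue (A \<inter> {0..a})"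
    using assms by (intro emeasure_mono) auto
  with a show "\<exists>aa. ereal a = ereal aa \<and> 0 \<le> aa \<and> emeasure lebesgue (B \<inter> {0..aa}) = 0"
    by auto
qed

lemma superlevel_nonneg: "superlevel \<phi> l \<subseteq> {0..}"
  by (auto simp: superlevel_def)

lemma emeasure_neq_0_if_measure: "measure M A \<noteq> 0 \<Longrightarrow> emeasure M A \<noteq> 0"
  by (auto simp: measure_def)

lemma convex_UN_incseq:
  fixes S :: "nat \<Rightarrow> 'a::real_vector set"
  assumes "incseq S" "\<And>n. convex (S n)"
  shows "convex (\<Union>n. S n)"
proof (rule convexI)
  fix x y :: 'a and u v :: real
  assume *: "x \<in> (\<Union>n. S n)" "y \<in> (\<Union>n. S n)" "0 \<le> u" "0 \<le> v" "u + v = 1"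
  then obtain m n where "x \<in> S m" "y \<in> S n" by auto
  then have "x \<in> S (max m n)" "y \<in> S (max m n)"
    using incseqD[OF assms(1)] by (meson max.cobounded1 max.cobounded2 subsetD)+
  then have "u *\<^sub>R x + v *\<^sub>R y \<in> S (max m n)"
    using assms(2) * by (intro convexD) auto
  then show "u *\<^sub>R x + v *\<^sub>R y \<in> (\<Union>n. S n)" by blast
qed

section \<open>Level intervals and strict superlevel sets of a tamping\<close>

context
  fixes \<phi> :: "real \<Rightarrow> real"
  assumes meas: "\<phi> \<in> borel_measurable half_line"
    and fin: "\<And>\<nu>. 0 < \<nu> \<Longrightarrow> emeasure lebesgue (superlevel \<phi> \<nu>) < \<infinity>"
begin

lemma fmeasurable_superlevel: "0 < \<nu> \<Longrightarrow> superlevel \<phi> \<nu> \<in> lmeasurable"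
  using fin sets_superlevel[OF meas] by (auto intro: fmeasurableI)

lemma S_level_eq:
  assumes "0 < \<nu>"
  shows "S_level \<nu> \<phi> = (if measure lebesgue (superlevel \<phi> \<nu>) = 0 then {}
    else {y_level \<nu> \<phi>..y_level \<nu> \<phi> + measure lebesgue (superlevel \<phi> \<nu>)})"
  using fin[OF assms] fmeasurable_superlevel[OF assms]
  by (auto simp: S_level_def measure_def enn2real_eq_0_iff Let_def)

lemma y_level_nonneg:
  assumes "0 < \<nu>" "measure lebesgue (superlevel \<phi> \<nu>) \<noteq> 0"
  shows "0 \<le> y_level \<nu> \<phi>"
proof -
  obtain x where x: "x_level \<nu> \<phi> = ereal x" "0 \<le> x"
    using inf_ess_real[OF sets_superlevel[OF meas] superlevel_nonneg emeasure_neq_0_if_measure[OF assms(2)]]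
    unfolding x_level_def by blast
  have "measure lebesgue (hollows_below \<infinity> \<phi> \<inter> {0..x}) \<le> measure lebesgue {0..x}"
    using sets_hollows_below_infinity[OF meas] by (intro measure_mono_fmeasurable) auto
  then show ?thesis using x by (simp add: y_level_def)
qed

lemma emeasure_S_level:
  assumes "0 < \<nu>"
  shows "emeasure lebesgue (S_level \<nu> \<phi>) = emeasure lebesgue (superlevel \<phi> \<nu>)"
  using fmeasurable_superlevel[OF assms]
  by (auto simp: S_level_eq[OF assms] emeasure_eq_measure2)

lemma S_level_subset: "0 < \<nu> \<Longrightarrow> S_level \<nu> \<phi> \<subseteq> {0..}"
  using y_level_nonneg by (auto simp: S_level_eq intro: order_trans)

text \<open>
  Between the essential infima of two levels, the complement of the hollows lies in the superlevel
  set of the lower level.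
\<close>

lemma S_level_antimono:
  assumes \<nu>: "0 < \<nu>" "\<nu> \<le> \<nu>'"
  shows "S_level \<nu>' \<phi> \<subseteq> S_level \<nu> \<phi>"
proof (cases "measure lebesgue (superlevel \<phi> \<nu>') = 0")
  case True
  then show ?thesis using \<nu> by (simp add: S_level_eq)
next
  case False
  define A where "A = superlevel \<phi> \<nu>"
  define A' where "A' = superlevel \<phi> \<nu>'"
  define H where "H = hollows_below \<infinity> \<phi>"
  have A: "A \<in> lmeasurable" and A': "A' \<in> lmeasurable"
    using fmeasurable_superlevel \<nu> by (auto simp: A_def A'_def)
  have A_sub: "A \<subseteq> {0..}" and A'_sub: "A' \<subseteq> {0..}"
    by (simp_all add: A_def A'_def superlevel_nonneg)
  have A'_A: "A' \<subseteq> A" using superlevel_antimono \<nu>(2) by (simp add: A_def A'_def)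
  have H: "H \<in> sets lebesgue" using sets_hollows_below_infinity[OF meas] by (simp add: H_def)
  have mA': "measure lebesgue A' > 0"
    using False by (simp add: A'_def zero_less_measure_iff)
  have mA: "measure lebesgue A > 0"
    using mA' measure_mono_fmeasurable[OF A'_A _ A] A' by (auto dest: fmeasurableD)
  obtain x where x: "inf_ess A = ereal x" "0 \<le> x"
    using inf_ess_real[OF fmeasurableD[OF A] A_sub emeasure_neq_0_if_measure[OF less_imp_neq[OF mA, symmetric]]]
    by blast
  obtain x' where x': "inf_ess A' = ereal x'" "0 \<le> x'" and null': "negligible (A' \<inter> {0..<x'})"
    using inf_ess_real[OF fmeasurableD[OF A'] A'_sub emeasure_neq_0_if_measure[OF less_imp_neq[OF mA', symmetric]]]
    by blast
  have "x \<le> x'"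
    using inf_ess_antimono[OF fmeasurableD[OF A] A'_A] x x' by simp
  \<comment> \<open>A point \<open>z\<close> of the gap has mass of \<open>A\<close> to its left
    because \<open>z > x\<close>, and to its right because \<open>A'\<close> lies in
    \<open>A\<close> and is essentially contained in \<open>{x'..}\<close>. So \<open>z\<close> is
    in the essential hull, and not being hollow it belongs to \<open>A\<close>.\<close>
  have gap: "{x<..<x'} - H \<subseteq> A \<inter> {x<..<x'}"
  proof
    fix z assume "z \<in> {x<..<x'} - H"
    then have z: "z \<in> {x<..<x'}" "z \<notin> H" by auto
    have "\<not> negligible (A \<inter> {..z})"
    proof
      assume "negligible (A \<inter> {..z})"
      then have "A \<inter> {0..z} \<in> null_sets lebesgue"
        unfolding negligible_iff_null_sets[symmetric] by (rule negligible_subset) auto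
      with emeasure_greater_inf_ess[of A z] x(1) z(1) show False by auto
    qed
    moreover have "\<not> negligible (A \<inter> {z..})"
    proof
      assume "negligible (A \<inter> {z..})"
      then have "negligible (A \<inter> {z..} \<union> A' \<inter> {0..<x'})" using null' by (rule negligible_Un)
      then have "negligible A'"
        by (rule negligible_subset) (use A'_A A'_sub z(1) in force)
      with mA' show False by (simp add: negligible_imp_measure0)
    qed
    ultimately have "z \<in> conv_ess A" by (rule mem_conv_ess)
    moreover have "z \<notin> hollows A" using z(2) by (auto simp: H_def hollows_below_def A_def)
    ultimately show "z \<in> A \<inter> {x<..<x'}" using z(1) by (simp add: hollows_def)
  qed
  have y: "y_level \<nu> \<phi> = x - measure lebesgue (H \<inter> {0..x})"
    "y_level \<nu>' \<phi> = x' - measure lebesgue (H \<inter> {0..x'})"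
    using x x' by (auto simp: y_level_def x_level_def H_def A_def A'_def)
  have Hx: "H \<inter> {a..b} \<in> lmeasurable" "H \<inter> {a<..<b} \<in> lmeasurable" for a b
    using H by (auto intro!: fmeasurable_Int_fmeasurable simp: Int_commute[of H])
  \<comment> \<open>Only the point \<open>x'\<close> is lost in this splitting; the open interval is
    the gap used above.\<close>
  have "measure lebesgue (H \<inter> {0..x'}) = measure lebesgue (H \<inter> {0..x} \<union> H \<inter> {x<..<x'})"
  proof (rule measure_negligible_symdiff[symmetric, OF Hx(1)])
    show "negligible (sym_diff (H \<inter> {0..x'}) (H \<inter> {0..x} \<union> H \<inter> {x<..<x'}))"
      by (rule negligible_subset[of "{x'}"]) (use \<open>x \<le> x'\<close> x(2) in auto)
  qed
  also have "\<dots> = measure lebesgue (H \<inter> {0..x}) + measure lebesgue (H \<inter> {x<..<x'})"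
    by (intro measure_Un_AE AE_I2 Hx) auto
  finally have H_split: "measure lebesgue (H \<inter> {0..x'}) =
      measure lebesgue (H \<inter> {0..x}) + measure lebesgue (H \<inter> {x<..<x'})" .
  have ivl: "measure lebesgue ({x<..<x'} - H) = (x' - x) - measure lebesgue (H \<inter> {x<..<x'})"
  proof -
    have "measure lebesgue ({x<..<x'} - H \<inter> {x<..<x'}) =
        measure lebesgue {x<..<x'} - measure lebesgue (H \<inter> {x<..<x'})"
      by (rule measurable_measure_Diff) (use H in auto)
    moreover have "{x<..<x'} - H \<inter> {x<..<x'} = {x<..<x'} - H" by auto
    ultimately show ?thesis using \<open>x \<le> x'\<close> by simp
  qed
  have dy: "y_level \<nu>' \<phi> - y_level \<nu> \<phi> = measure lebesgue ({x<..<x'} - H)"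
    using H_split ivl y by simp
  \<comment> \<open>The non-hollow part of the gap and the part of \<open>A'\<close> from
    \<open>x'\<close> on are disjoint pieces of \<open>A\<close>. Combined with \<open>dy\<close>,
    this compares the right endpoints.\<close>
  have "measure lebesgue ({x<..<x'} - H) + measure lebesgue (A' \<inter> {x'..}) =
      measure lebesgue (({x<..<x'} - H) \<union> (A' \<inter> {x'..}))"
    by (intro measure_Un_AE[symmetric] AE_I2 fmeasurable_Diff fmeasurable_Int_fmeasurable A' H) auto
  also have "\<dots> \<le> measure lebesgue A"
    using gap A'_A fmeasurableD[OF A'] H by (intro measure_mono_fmeasurable sets.Un sets.Diff sets.Int A) auto
  also have "measure lebesgue (A' \<inter> {x'..}) = measure lebesgue A'"
  proof (rule measure_negligible_symdiff[OF A'])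
    show "negligible (sym_diff A' (A' \<inter> {x'..}))"
      by (rule negligible_subset[OF null']) (use A'_sub in auto)
  qed
  finally have "y_level \<nu>' \<phi> + measure lebesgue A' \<le> y_level \<nu> \<phi> + measure lebesgue A"
    using dy by simp
  moreover have "y_level \<nu> \<phi> \<le> y_level \<nu>' \<phi>"
    using dy measure_nonneg[of lebesgue "{x<..<x'} - H"] by linarith
  ultimately show ?thesis
    using \<nu> mA mA' by (auto simp: S_level_eq A_def A'_def)
qed

text \<open>A supremum exceeds \<open>c\<close> iff some admissible level does, and nestedness
  allows that level to be lowered to one of the form \<open>c + 1 / Suc n\<close>. With a strict
  inequality the identity holds for every \<open>c\<close>.\<close>

lemma tamping_greater_eq:
  assumes "0 \<le> c"
  shows "{x. ennreal c < tamping \<phi> x} = (\<Union>n::nat. S_level (c + 1 / Suc n) \<phi>)"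
proof (intro equalityI subsetI)
  fix x assume "x \<in> {x. ennreal c < tamping \<phi> x}"
  then obtain \<nu> where \<nu>: "c < \<nu>" "x \<in> S_level \<nu> \<phi>"
    using assms by (auto simp: tamping_def less_Sup_iff ennreal_less_iff)
  then obtain n :: nat where "1 / Suc n < \<nu> - c" using nat_approx_posE[of "\<nu> - c"] by auto
  then have "S_level \<nu> \<phi> \<subseteq> S_level (c + 1 / Suc n) \<phi>"
    using assms by (intro S_level_antimono add_nonneg_pos) auto
  with \<nu> show "x \<in> (\<Union>n::nat. S_level (c + 1 / Suc n) \<phi>)" by auto
next
  fix x assume "x \<in> (\<Union>n::nat. S_level (c + 1 / Suc n) \<phi>)"
  then obtain n :: nat where n: "x \<in> S_level (c + 1 / Suc n) \<phi>" by auto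
  have "ennreal c < ennreal (c + 1 / Suc n)" using assms by (simp add: ennreal_less_iff)
  moreover have "0 < c + 1 / Suc n" using assms by (intro add_nonneg_pos) auto
  ultimately show "x \<in> {x. ennreal c < tamping \<phi> x}"
    using n by (auto simp: tamping_def less_Sup_iff)
qed

lemma incseq_S_level:
  assumes "0 \<le> c"
  shows "incseq (\<lambda>n::nat. S_level (c + 1 / Suc n) \<phi>)"
  using assms by (intro monoI S_level_antimono add_nonneg_pos) (auto simp: frac_le)

lemma is_interval_tamping_greater: "is_interval {x. c < tamping \<phi> x}"
proof (cases c)
  case (real r)
  have "convex (\<Union>n::nat. S_level (r + 1 / Suc n) \<phi>)"
  proof (rule convex_UN_incseq[OF incseq_S_level[OF real(1)]])
    fix n :: nat
    have "0 < r + 1 / Suc n" using real(1) by (intro add_nonneg_pos) auto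
    from S_level_eq[OF this] show "convex (S_level (r + 1 / Suc n) \<phi>)" by auto
  qed
  then show ?thesis
    unfolding real(2) is_interval_convex_1 tamping_greater_eq[OF real(1)] .
qed simp

lemma tamping_pos_subset: "{x. c < tamping \<phi> x} \<subseteq> {0..}"
proof -
  have "{x. c < tamping \<phi> x} \<subseteq> {x. ennreal 0 < tamping \<phi> x}"
    by (auto intro: le_less_trans[OF zero_le])
  also have "\<dots> \<subseteq> {0..}"
    unfolding tamping_greater_eq[OF order_refl] by (intro UN_least S_level_subset) simp
  finally show ?thesis .
qed

lemma tamping_borel_measurable: "tamping \<phi> \<in> borel_measurable half_line"
proof (rule borel_measurableI_greater)
  fix c
  have "{x. c < tamping \<phi> x} \<in> sets lebesgue"
    using is_interval_tamping_greater by (intro convex_real_sets_lebesgue) (simp add: is_interval_convex_1)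
  moreover have "{x \<in> space half_line. c < tamping \<phi> x} = {x. c < tamping \<phi> x}"
    using tamping_pos_subset[of c] by (auto simp: space_restrict_space)
  ultimately show "{x \<in> space half_line. c < tamping \<phi> x} \<in> sets half_line"
    using tamping_pos_subset[of c] by (simp add: sets_restrict_space_iff)
qed

text \<open>Continuity from below along the increasing level intervals: each has the measure of
  \<open>superlevel \<phi> (c + 1 / Suc n)\<close>, which lies in the strict superlevel set of
  \<open>\<phi>\<close> above \<open>c\<close>.\<close>

lemma emeasure_tamping_greater_le:
  assumes "0 \<le> c"
  shows "emeasure half_line {x \<in> space half_line. ennreal c < tamping \<phi> x} \<le>
    emeasure half_line {x \<in> space half_line. c < \<phi> x}"
proof -
  have set_eq: "{x \<in> space half_line. ennreal c < tamping \<phi> x} = (\<Union>n::nat. S_level (c + 1 / Suc n) \<phi>)"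
    using tamping_pos_subset[of "ennreal c"] tamping_greater_eq[OF assms]
    by (auto simp: space_restrict_space)
  have "\<dots> \<subseteq> {0..}" using S_level_subset assms by (intro UN_least S_level_subset add_nonneg_pos) auto
  then have "emeasure half_line {x \<in> space half_line. ennreal c < tamping \<phi> x} =
      emeasure lebesgue (\<Union>n::nat. S_level (c + 1 / Suc n) \<phi>)"
    unfolding set_eq by (intro emeasure_restrict_space) auto
  also have "\<dots> = (SUP n::nat. emeasure lebesgue (S_level (c + 1 / Suc n) \<phi>))"
    by (rule SUP_emeasure_incseq[symmetric, OF _ incseq_S_level[OF assms]])
      (use assms in \<open>auto simp: S_level_eq add_nonneg_pos\<close>)
  also have "\<dots> \<le> emeasure half_line {x \<in> space half_line. c < \<phi> x}"
  proof (rule SUP_least)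
    fix n :: nat
    have "emeasure lebesgue (S_level (c + 1 / Suc n) \<phi>) = emeasure lebesgue (superlevel \<phi> (c + 1 / Suc n))"
      using assms by (intro emeasure_S_level add_nonneg_pos) auto
    also have "\<dots> = emeasure half_line (superlevel \<phi> (c + 1 / Suc n))"
      by (intro emeasure_restrict_space[symmetric]) (auto simp: superlevel_def)
    also have "\<dots> \<le> emeasure half_line {x \<in> space half_line. c < \<phi> x}"
    proof (rule emeasure_mono)
      have "c < \<phi> x" if "c + 1 / Suc n \<le> \<phi> x" for x
        by (rule less_le_trans[OF _ that]) simp
      then show "superlevel \<phi> (c + 1 / Suc n) \<subseteq> {x \<in> space half_line. c < \<phi> x}"
        unfolding superlevel_def space_restrict_space by (auto simp del: of_nat_Suc)
      show "{x \<in> space half_line. c < \<phi> x} \<in> sets half_line"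
        using meas by measurable
    qed
    finally show "emeasure lebesgue (S_level (c + 1 / Suc n) \<phi>) \<le> \<dots>" .
  qed
  finally show ?thesis .
qed

end

subsection \<open>Selection of pointwise convergent subsequences\<close>

text \<open>Extended reals are compact, so both endpoints converge along a subsequence, possibly to
  infinite limits. A point different from both limits is eventually strictly between the endpoints
  or strictly outside.\<close>

lemma interval_sequence_subseq:
  fixes U :: "nat \<Rightarrow> real set"
  assumes "\<And>n. is_interval (U n)"
  shows "\<exists>r N. strict_mono (r :: nat \<Rightarrow> nat) \<and> countable N \<and>
    (\<forall>x. x \<notin> N \<longrightarrow> (\<forall>\<^sub>F n in sequentially. x \<in> U (r n)) \<or> (\<forall>\<^sub>F n in sequentially. x \<notin> U (r n)))"
proof -
  \<comment> \<open>An empty \<open>U n\<close> yields infimum \<open>\<infinity>\<close> and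
    supremum \<open>-\<infinity>\<close>, so it needs no separate treatment.\<close>
  define A where "A n = Inf (ereal ` U n)" for n
  define B where "B n = Sup (ereal ` U n)" for n
  obtain a s where s: "strict_mono (s :: nat \<Rightarrow> nat)" "(A \<circ> s) \<longlonglongrightarrow> a"
    using compact_complete_linorder[of A] by blast
  obtain b t where t: "strict_mono (t :: nat \<Rightarrow> nat)" "(B \<circ> s \<circ> t) \<longlonglongrightarrow> b"
    using compact_complete_linorder[of "B \<circ> s"] by blast
  have lims: "(\<lambda>n. A (s (t n))) \<longlonglongrightarrow> a" "(\<lambda>n. B (s (t n))) \<longlonglongrightarrow> b"
    using LIMSEQ_subseq_LIMSEQ[OF s(2) t(1)] t(2) unfolding o_def by this+
  \<comment> \<open>\<open>real_of_ereal\<close> sends an infinite limit to 0, which at worst adds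
    one spurious exceptional point.\<close>
  show ?thesis
  proof (intro exI[of _ "s \<circ> t"] exI[of _ "{real_of_ereal a, real_of_ereal b}"] conjI allI impI)
    show "strict_mono (s \<circ> t)" using s(1) t(1) by (rule strict_mono_o)
  next
    fix x assume "x \<notin> {real_of_ereal a, real_of_ereal b}"
    then have ne: "ereal x \<noteq> a" "ereal x \<noteq> b" by auto
    consider "ereal x < a" | "b < ereal x" | "a < ereal x" "ereal x < b"
      using ne linorder_less_linear[of "ereal x" a] linorder_less_linear[of "ereal x" b] by blast
    then show "(\<forall>\<^sub>F n in sequentially. x \<in> U ((s \<circ> t) n)) \<or> (\<forall>\<^sub>F n in sequentially. x \<notin> U ((s \<circ> t) n))"
    proof cases
      case 1
      have "\<forall>\<^sub>F n in sequentially. x \<notin> U ((s \<circ> t) n)"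
        using order_tendstoD(1)[OF lims(1) 1]
      proof eventually_elim
        case (elim n)
        then show ?case using INF_lower[of x "U (s (t n))" ereal] by (auto simp: A_def)
      qed
      then show ?thesis ..
    next
      case 2
      have "\<forall>\<^sub>F n in sequentially. x \<notin> U ((s \<circ> t) n)"
        using order_tendstoD(2)[OF lims(2) 2]
      proof eventually_elim
        case (elim n)
        then show ?case using SUP_upper[of x "U (s (t n))" ereal] by (auto simp: B_def)
      qed
      then show ?thesis ..
    next
      case 3
      have "\<forall>\<^sub>F n in sequentially. x \<in> U ((s \<circ> t) n)"
        using order_tendstoD(2)[OF lims(1) 3(1)] order_tendstoD(1)[OF lims(2) 3(2)]
      proof eventually_elim
        case (elim n)
        obtain y where y: "y \<in> U (s (t n))" "ereal y < ereal x"
          using elim(1) unfolding A_def INF_less_iff by blast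
        obtain z where z: "z \<in> U (s (t n))" "ereal x < ereal z"
          using elim(2) unfolding B_def less_SUP_iff by blast
        from assms[of "s (t n)"] y(1) z(1) have "x \<in> U (s (t n))"
          by (rule mem_is_interval_1_I) (use y(2) z(2) in simp_all)
        then show ?case by simp
      qed
      then show ?thesis ..
    qed
  qed auto
qed

text \<open>
  A variant of Helly's selection theorem, with monotonicity replaced by convexity of superlevel sets.
\<close>

lemma quasiconcave_convergent_subseq:
  fixes f :: "nat \<Rightarrow> real \<Rightarrow> ennreal"
  assumes "\<And>n c. is_interval {x. c < f n x}"
  shows "\<exists>r N. strict_mono (r :: nat \<Rightarrow> nat) \<and> countable N \<and>
    (\<forall>x. x \<notin> N \<longrightarrow> convergent (\<lambda>n. f (r n) x))"
proof -
  \<comment> \<open>This enumerates all rational thresholds; negative ones become 0 in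
    \<open>ennreal\<close>.\<close>
  define q where "q k = ennreal (real_of_rat (from_nat k))" for k
  define decided where "decided k s x \<longleftrightarrow>
    (\<forall>\<^sub>F n in sequentially. q k < f (s n) x) \<or> (\<forall>\<^sub>F n in sequentially. \<not> q k < f (s n) x)"
    for k :: nat and s :: "nat \<Rightarrow> nat" and x
  define P where "P k s \<longleftrightarrow> (\<exists>N. countable N \<and> (\<forall>x. x \<notin> N \<longrightarrow> decided k s x))" for k s
  interpret subseqs P
  proof
    fix k and s :: "nat \<Rightarrow> nat" assume "strict_mono s"
    show "\<exists>r'. strict_mono r' \<and> P k (s \<circ> r')"
      using interval_sequence_subseq[of "\<lambda>n. {x. q k < f (s n) x}"] assms
      by (auto simp: P_def decided_def)
  qed
  have P_diag: "P k (diagseq \<circ> (+) (Suc k))" for k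
  proof (rule diagseq_holds)
    fix r s :: "nat \<Rightarrow> nat" and k assume r: "strict_mono r" and "P k s"
    have "decided k (s \<circ> r) x" if "decided k s x" for x
      using that eventually_subseq[OF r] by (auto simp: decided_def)
    with \<open>P k s\<close> show "P k (s \<circ> r)" unfolding P_def by blast
  qed
  have "\<exists>N. countable N \<and> (\<forall>x. x \<notin> N \<longrightarrow> decided k diagseq x)" for k
  proof -
    \<comment> \<open>The diagonal sequence is controlled only from index \<open>Suc k\<close> on,
      but being decided is unaffected by finitely many terms.\<close>
    have "decided k diagseq x" if "decided k (diagseq \<circ> (+) (Suc k)) x" for x
      using that eventually_sequentially_seg[of "\<lambda>n. q k < f (diagseq n) x" "Suc k"]
        eventually_sequentially_seg[of "\<lambda>n. \<not> q k < f (diagseq n) x" "Suc k"]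
      by (simp add: decided_def add.commute)
    with P_diag[of k] show ?thesis unfolding P_def by blast
  qed
  then obtain N where N: "\<And>k. countable (N k)" "\<And>k x. x \<notin> N k \<Longrightarrow> decided k diagseq x"
    by metis
  show ?thesis
  proof (intro exI[of _ diagseq] exI[of _ "\<Union>k. N k"] conjI allI impI)
    fix x assume "x \<notin> (\<Union>k. N k)"
    then have dec: "decided k diagseq x" for k using N(2) by auto
    let ?X = "\<lambda>n. f (diagseq n) x"
    \<comment> \<open>A rational threshold strictly between the two would be crossed infinitely
      often in both directions, whereas every threshold is decided at \<open>x\<close>.\<close>
    have "\<not> liminf ?X < limsup ?X"
    proof
      assume "liminf ?X < limsup ?X"
      then obtain c :: rat where c: "liminf ?X < real_of_rat c" "real_of_rat c < limsup ?X"
        using ennreal_rat_dense by blast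
      obtain k where k: "q k = ennreal (real_of_rat c)"
        by (metis q_def from_nat_to_nat)
      from dec[of k] show False unfolding decided_def
      proof
        assume "\<forall>\<^sub>F n in sequentially. q k < ?X n"
        then have "q k \<le> liminf ?X"
          by (intro Liminf_bounded) (auto elim: eventually_mono)
        with c(1) k show False by simp
      next
        assume "\<forall>\<^sub>F n in sequentially. \<not> q k < ?X n"
        then have "limsup ?X \<le> q k"
          by (intro Limsup_bounded) (auto elim: eventually_mono)
        with c(2) k show False by simp
      qed
    qed
    then have "liminf ?X = limsup ?X"
      using Liminf_le_Limsup[of sequentially ?X] by simp
    then have "?X \<longlonglongrightarrow> liminf ?X"
      by (simp add: tendsto_iff_Liminf_eq_Limsup)
    then show "convergent ?X" by (rule convergentI)
  qed (use N(1) subseq_diagseq in auto)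
qed

subsection \<open>Tamping in Lebesgue spaces\<close>

text \<open>Markov's inequality for the \<open>p\<close>-th power.\<close>

lemma powr_times_emeasure_le:
  fixes f :: "'a \<Rightarrow> real"
  assumes "0 \<le> c" "0 \<le> p" and [measurable]: "f \<in> borel_measurable M"
  shows "ennreal (c powr p) * emeasure M {x \<in> space M. c \<le> \<bar>f x\<bar>} \<le> (\<integral>\<^sup>+x. ennreal (\<bar>f x\<bar> powr p) \<partial>M)"
proof -
  have "ennreal (c powr p) * emeasure M {x \<in> space M. c \<le> \<bar>f x\<bar>} =
      (\<integral>\<^sup>+x. ennreal (c powr p) * indicator {x \<in> space M. c \<le> \<bar>f x\<bar>} x \<partial>M)"
    by (rule nn_integral_cmult_indicator[symmetric]) measurable
  also have "\<dots> \<le> (\<integral>\<^sup>+x. ennreal (\<bar>f x\<bar> powr p) \<partial>M)"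
    using assms by (intro nn_integral_mono) (auto simp: indicator_def intro!: ennreal_leI powr_mono2)
  finally show ?thesis .
qed

context
  fixes p :: real and \<phi> :: "real \<Rightarrow> real"
  assumes p: "0 < p" and \<phi>: "\<phi> \<in> Lp p half_line"
begin

lemma nn_integral_powr_finite: "(\<integral>\<^sup>+x. ennreal (\<bar>\<phi> x\<bar> powr p) \<partial>half_line) < \<infinity>"
  using LpD(2)[OF \<phi>] by (simp add: nn_integral_eq_integral)

lemma emeasure_superlevel_finite:
  assumes "0 < \<nu>"
  shows "emeasure lebesgue (superlevel \<phi> \<nu>) < \<infinity>"
proof -
  note [measurable] = LpD(1)[OF \<phi>]
  have "emeasure lebesgue (superlevel \<phi> \<nu>) = emeasure half_line (superlevel \<phi> \<nu>)"
    by (rule emeasure_restrict_space[symmetric]) (auto simp: superlevel_def)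
  also have "\<dots> \<le> emeasure half_line {x \<in> space half_line. \<nu> \<le> \<bar>\<phi> x\<bar>}"
    by (rule emeasure_mono, force simp: superlevel_def space_restrict_space) measurable
  also have "\<dots> < \<infinity>"
  proof -
    have "ennreal (\<nu> powr p) * emeasure half_line {x \<in> space half_line. \<nu> \<le> \<bar>\<phi> x\<bar>} < \<infinity>"
      using powr_times_emeasure_le[of \<nu> p \<phi> half_line] nn_integral_powr_finite assms p
      by (auto intro: le_less_trans)
    then show ?thesis using assms by (auto simp: ennreal_mult_less_top)
  qed
  finally show ?thesis .
qed

lemma emeasure_tamping_greater_abs_le:
  assumes "0 \<le> c"
  shows "emeasure half_line {x \<in> space half_line. ennreal c < tamping \<phi> x} \<le>
    emeasure half_line {x \<in> space half_line. c < \<bar>\<phi> x\<bar>}"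
proof -
  note [measurable] = LpD(1)[OF \<phi>]
  have "emeasure half_line {x \<in> space half_line. c < \<phi> x} \<le> emeasure half_line {x \<in> space half_line. c < \<bar>\<phi> x\<bar>}"
    by (rule emeasure_mono, force) measurable
  with emeasure_tamping_greater_le[OF LpD(1)[OF \<phi>] emeasure_superlevel_finite assms]
  show ?thesis by (rule order_trans)
qed

text \<open>The infinity set lies in all strict superlevel sets, so \<open>c powr p\<close> times
  its measure is bounded uniformly in \<open>c\<close>.\<close>

lemma AE_tamping_finite: "AE x in half_line. tamping \<phi> x < \<infinity>"
proof -
  note [measurable] = LpD(1)[OF \<phi>] tamping_borel_measurable[OF LpD(1)[OF \<phi>] emeasure_superlevel_finite]
  define E where "E = emeasure half_line {x \<in> space half_line. tamping \<phi> x = \<infinity>}"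
  define I where "I = (\<integral>x. \<bar>\<phi> x\<bar> powr p \<partial>half_line)"
  have I: "(\<integral>\<^sup>+x. ennreal (\<bar>\<phi> x\<bar> powr p) \<partial>half_line) = ennreal I" "0 \<le> I"
    using LpD(2)[OF \<phi>] by (auto simp: I_def nn_integral_eq_integral)
  have le: "ennreal (c powr p) * E \<le> ennreal I" if "0 \<le> c" for c
  proof -
    have "E \<le> emeasure half_line {x \<in> space half_line. ennreal c < tamping \<phi> x}"
      unfolding E_def by (rule emeasure_mono, force) measurable
    also have "\<dots> \<le> emeasure half_line {x \<in> space half_line. c < \<bar>\<phi> x\<bar>}"
      by (rule emeasure_tamping_greater_abs_le[OF that])
    also have "\<dots> \<le> emeasure half_line {x \<in> space half_line. c \<le> \<bar>\<phi> x\<bar>}"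
      by (rule emeasure_mono, force) measurable
    finally have "ennreal (c powr p) * E \<le> ennreal (c powr p) * \<dots>" by (rule mult_left_mono) simp
    also have "\<dots> \<le> ennreal I"
      using powr_times_emeasure_le[of c p \<phi> half_line] that p I by simp
    finally show ?thesis .
  qed
  have "E = 0"
  proof (cases E)
    case (real e)
    show ?thesis
    proof (rule ccontr)
      assume "E \<noteq> 0"
      with real have "0 < e" by (cases "e = 0") auto
      \<comment> \<open>With this \<open>c\<close> the left side of \<open>le\<close> equals
        \<open>I + 1\<close>.\<close>
      define c where "c = ((I + 1) / e) powr (1 / p)"
      have "c powr p = (I + 1) / e"
        using \<open>0 < e\<close> I(2) p by (simp add: c_def powr_powr)
      then have "ennreal (c powr p) * E = ennreal (I + 1)"
        using real \<open>0 < e\<close> I(2) by (simp add: ennreal_mult[symmetric])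
      with le[of c] I(2) show False by (simp add: c_def ennreal_le_iff)
    qed
  next
    case top
    with le[of 1] show ?thesis by (simp add: top_unique)
  qed
  then have "{x \<in> space half_line. tamping \<phi> x = \<infinity>} \<in> null_sets half_line"
    unfolding E_def by (rule null_setsI) measurable
  then show ?thesis by (rule AE_I') (auto simp: not_less top_unique)
qed

lemma nn_integral_tamping_powr_le:
  "(\<integral>\<^sup>+x. ennreal (\<bar>enn2real (tamping \<phi> x)\<bar> powr p) \<partial>half_line) \<le>
    (\<integral>\<^sup>+x. ennreal (\<bar>\<phi> x\<bar> powr p) \<partial>half_line)"
proof -
  note [measurable] = LpD(1)[OF \<phi>] tamping_borel_measurable[OF LpD(1)[OF \<phi>] emeasure_superlevel_finite]
  show ?thesis
  proof (rule sigma_finite_measure.nn_integral_powr_le_of_distribution_le[OF sigma_finite_half_line p])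
    fix c :: real assume c: "0 \<le> c"
    \<comment> \<open>Since \<open>enn2real\<close> sends infinity to 0, only this implication holds
      in general.\<close>
    have "c < enn2real t \<Longrightarrow> ennreal c < t" for t
      using c by (cases t) (auto simp: ennreal_less_iff)
    then have "{x \<in> space half_line. c < \<bar>enn2real (tamping \<phi> x)\<bar>} \<subseteq>
        {x \<in> space half_line. ennreal c < tamping \<phi> x}"
      by auto
    then have "emeasure half_line {x \<in> space half_line. c < \<bar>enn2real (tamping \<phi> x)\<bar>} \<le>
        emeasure half_line {x \<in> space half_line. ennreal c < tamping \<phi> x}"
      by (rule emeasure_mono) measurable
    also have "\<dots> \<le> emeasure half_line {x \<in> space half_line. c < \<bar>\<phi> x\<bar>}"
      by (rule emeasure_tamping_greater_abs_le[OF c])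
    finally show "emeasure half_line {x \<in> space half_line. c < \<bar>enn2real (tamping \<phi> x)\<bar>} \<le> \<dots>" .
  qed measurable
qed

lemma tamping_in_Lp: "(\<lambda>x. enn2real (tamping \<phi> x)) \<in> Lp p half_line"
proof -
  note [measurable] = tamping_borel_measurable[OF LpD(1)[OF \<phi>] emeasure_superlevel_finite]
  have "(\<integral>\<^sup>+x. ennreal (\<bar>enn2real (tamping \<phi> x)\<bar> powr p) \<partial>half_line) < \<infinity>"
    using nn_integral_tamping_powr_le nn_integral_powr_finite by (rule le_less_trans)
  then show ?thesis by (auto simp: Lp_def intro!: integrableI_nonneg)
qed

lemma integral_tamping_powr_le:
  "(\<integral>x. \<bar>enn2real (tamping \<phi> x)\<bar> powr p \<partial>half_line) \<le> (\<integral>x. \<bar>\<phi> x\<bar> powr p \<partial>half_line)"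
  using nn_integral_tamping_powr_le LpD(2)[OF \<phi>] LpD(2)[OF tamping_in_Lp]
  by (simp add: nn_integral_eq_integral ennreal_le_iff)

end

lemma Lp_norm_le_iff:
  assumes "0 < p" "0 \<le> C"
  shows "Lp_norm p M f \<le> C \<longleftrightarrow> (\<integral>x. \<bar>f x\<bar> powr p \<partial>M) \<le> C powr p"
proof -
  let ?I = "\<integral>x. \<bar>f x\<bar> powr p \<partial>M"
  have "?I powr (1 / p) \<le> C \<longleftrightarrow> ?I powr (1 / p) \<le> (C powr p) powr (1 / p)"
    using assms by (simp add: powr_powr)
  also have "\<dots> \<longleftrightarrow> ?I \<le> C powr p"
    using assms powr_mono2[of "1 / p" ?I "C powr p"] powr_less_mono2[of "1 / p" "C powr p" ?I]
    by fastforce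
  finally show ?thesis by (simp add: Lp_norm_def)
qed

text \<open>
  Pointwise limits may be infinite a priori; Fatou's lemma excludes this almost everywhere.
\<close>

lemma AE_liminf_finite:
  fixes f :: "nat \<Rightarrow> 'a \<Rightarrow> ennreal"
  assumes p: "0 < p" and [measurable]: "\<And>n. f n \<in> borel_measurable M"
    and fin: "\<And>n. AE x in M. f n x < \<infinity>"
    and K: "\<And>n. (\<integral>\<^sup>+x. ennreal (\<bar>enn2real (f n x)\<bar> powr p) \<partial>M) \<le> ennreal K"
  shows "AE x in M. liminf (\<lambda>n. f n x) < \<infinity>"
proof -
  have "(\<integral>\<^sup>+x. liminf (\<lambda>n. ennreal (\<bar>enn2real (f n x)\<bar> powr p)) \<partial>M) \<le>
      liminf (\<lambda>n. \<integral>\<^sup>+x. ennreal (\<bar>enn2real (f n x)\<bar> powr p) \<partial>M)"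
    by (rule nn_integral_liminf) measurable
  also have "\<dots> \<le> liminf (\<lambda>n. ennreal K)"
    using K by (intro Liminf_mono always_eventually allI)
  also have "\<dots> < \<infinity>" by (simp add: Liminf_const)
  finally have "AE x in M. liminf (\<lambda>n. ennreal (\<bar>enn2real (f n x)\<bar> powr p)) \<noteq> \<infinity>"
    by (intro nn_integral_noteq_infinite) auto
  \<comment> \<open>Where \<open>f n x\<close> is infinite, \<open>enn2real\<close> gives 0 and a
    bound on the power would say nothing about \<open>f n x\<close>.\<close>
  moreover have "AE x in M. \<forall>n. f n x < \<infinity>" using fin by (simp add: AE_all_countable)
  ultimately show ?thesis
  proof eventually_elim
    case (elim x)
    \<comment> \<open>A finite \<open>l\<close> above this liminf bounds the powers infinitely
      often, hence bounds \<open>f n x\<close> by \<open>l powr (1 / p)\<close> infinitely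
      often.\<close>
    define L where "L = liminf (\<lambda>n. ennreal (\<bar>enn2real (f n x)\<bar> powr p))"
    obtain l where l: "L < ennreal l" "0 \<le> l"
      using elim(1) by (metis L_def ennreal_Ex_less_of_nat ennreal_of_nat_eq_real_of_nat infinity_ennreal_def less_top of_nat_0_le_iff)
    have "\<exists>\<^sub>F n in sequentially. ennreal (\<bar>enn2real (f n x)\<bar> powr p) < ennreal l"
      using l(1) Liminf_bounded[of "ennreal l" "\<lambda>n. ennreal (\<bar>enn2real (f n x)\<bar> powr p)" sequentially]
      by (auto simp: frequently_def not_less L_def)
    then have "\<exists>\<^sub>F n in sequentially. f n x \<le> ennreal (l powr (1 / p))"
    proof (rule frequently_elim1)
      fix n assume "ennreal (\<bar>enn2real (f n x)\<bar> powr p) < ennreal l"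
      then have "\<bar>enn2real (f n x)\<bar> powr p \<le> l" using l(2) by (simp add: ennreal_less_iff)
      then have "(\<bar>enn2real (f n x)\<bar> powr p) powr (1 / p) \<le> l powr (1 / p)"
        using p by (intro powr_mono2) auto
      then have "enn2real (f n x) \<le> l powr (1 / p)" using p by (simp add: powr_powr)
      then have "ennreal (enn2real (f n x)) \<le> ennreal (l powr (1 / p))" by (rule ennreal_leI)
      moreover have "f n x < top" using elim(2) by simp
      ultimately show "f n x \<le> ennreal (l powr (1 / p))" by (simp only: ennreal_enn2real)
    qed
    moreover have "liminf (\<lambda>n. f n x) \<le> ennreal (l powr (1 / p))"
    proof (rule ccontr)
      assume "\<not> ?thesis"
      then have "\<forall>\<^sub>F n in sequentially. ennreal (l powr (1 / p)) < f n x"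
        by (intro less_LiminfD) simp
      with calculation show False by (simp add: frequently_def not_le)
    qed
    ultimately show ?case by (auto intro: le_less_trans)
  qed
qed

theorem corollary3p7:
  fixes p :: real and \<phi> :: "nat \<Rightarrow> real \<Rightarrow> real"
  assumes "1 < p"
    and "\<And>n. \<phi> n \<in> Lp p half_line"
    and "\<And>n. AE x in half_line. 0 \<le> \<phi> n x"
    and "\<exists>C. \<forall>n. Lp_norm p half_line (\<phi> n) \<le> C"
    and "\<exists>\<mu>>0. limsup (\<lambda>n. x_level \<mu> (\<phi> n)) < \<infinity>"
  shows "(\<forall>n. AE x in half_line. tamping (\<phi> n) x < \<infinity>) \<and>
    (\<exists>r g. strict_mono r \<and>
      weakly_converges_Lp p half_line (\<lambda>k x. enn2real (tamping (\<phi> (r k)) x)) g)"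
proof
  have p: "0 < p" using assms(1) by simp
  note \<phi> = assms(2)
  show fin: "\<forall>n. AE x in half_line. tamping (\<phi> n) x < \<infinity>"
    using AE_tamping_finite[OF p \<phi>] by blast
  obtain C where C: "\<And>n. Lp_norm p half_line (\<phi> n) \<le> C" using assms(4) by blast
  have "0 \<le> C" using C[of 0] by (rule order_trans[rotated]) (simp add: Lp_norm_def)
  define K where "K = C powr p"
  have K: "(\<integral>x. \<bar>\<phi> n x\<bar> powr p \<partial>half_line) \<le> K" for n
    using C[of n] unfolding K_def Lp_norm_le_iff[OF p \<open>0 \<le> C\<close>] .
  note meas [measurable] = tamping_borel_measurable[OF LpD(1)[OF \<phi>] emeasure_superlevel_finite[OF p \<phi>]]
  obtain r N where r: "strict_mono (r :: nat \<Rightarrow> nat)" and N: "countable N"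
    and conv: "\<And>x. x \<notin> N \<Longrightarrow> convergent (\<lambda>k. tamping (\<phi> (r k)) x)"
    using quasiconcave_convergent_subseq[of "\<lambda>n. tamping (\<phi> n)"]
      is_interval_tamping_greater[OF LpD(1)[OF \<phi>] emeasure_superlevel_finite[OF p \<phi>]]
    by blast
  have K': "(\<integral>x. \<bar>enn2real (tamping (\<phi> n) x)\<bar> powr p \<partial>half_line) \<le> K" for n
    using integral_tamping_powr_le[OF p \<phi>] K by (rule order_trans)
  have "AE x in half_line. liminf (\<lambda>k. tamping (\<phi> (r k)) x) < \<infinity>"
  proof (rule AE_liminf_finite[OF p])
    show "(\<integral>\<^sup>+x. ennreal (\<bar>enn2real (tamping (\<phi> (r k)) x)\<bar> powr p) \<partial>half_line) \<le> ennreal K" for k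
      using K'[of "r k"] LpD(2)[OF tamping_in_Lp[OF p \<phi>[of "r k"]]]
      by (simp add: nn_integral_eq_integral ennreal_leI)
  qed (use fin in auto)
  moreover have "AE x in half_line. x \<notin> N"
  proof (rule AE_I')
    have "N \<inter> {0..} \<in> null_sets lebesgue"
      using N by (intro null_sets_completionI countable_imp_null_set_lborel) auto
    then show "N \<inter> {0..} \<in> null_sets half_line"
      by (simp add: null_sets_restrict_space)
  qed (auto simp: space_restrict_space)
  \<comment> \<open>Writing the limit as a liminf defines it on the exceptional set too and makes
    its measurability immediate.\<close>
  ultimately have lim: "AE x in half_line. (\<lambda>k. enn2real (tamping (\<phi> (r k)) x)) \<longlonglongrightarrow>
      enn2real (liminf (\<lambda>k. tamping (\<phi> (r k)) x))"
  proof eventually_elim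
    case (elim x)
    have "(\<lambda>k. tamping (\<phi> (r k)) x) \<longlonglongrightarrow> liminf (\<lambda>k. tamping (\<phi> (r k)) x)"
      using conv[OF elim(2)] by (simp add: convergent_LIMSEQ_iff convergent_liminf_cl)
    then show ?case using elim(1) by (intro tendsto_enn2real) auto
  qed
  show "\<exists>r g. strict_mono r \<and>
      weakly_converges_Lp p half_line (\<lambda>k x. enn2real (tamping (\<phi> (r k)) x)) g"
    by (intro exI conjI, rule r, rule weakly_converges_LpI_AE[OF assms(1) _ _ lim K'])
      (use tamping_in_Lp[OF p \<phi>] in auto)
qed

end
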